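(* Let $F:\{0,1\}^n\times\{0,1\}^n\to\{0,1\}$. If $F$ is computed by a $\mathsf{THR}\circ\mathsf{THR}$ circuit of size $s$, then $F$ has an $\mathsf{RP}\cdot\mathsf{UPP}^{cc}$ protocol of cost $O(\log s)$.
   Context: $\mathsf{THR}\circ\mathsf{THR}$: depth-two circuit of linear threshold gates ($\mathsf{THR}_{w,t}(z)=1$ iff $w\cdot z\ge t$) on the $2n$ input bits. An $\mathsf{RP}\cdot\mathsf{UPP}^{cc}$ protocol of cost $c$ for $F$ (Alice holds $x$, Bob holds $y$): Alice and Bob toss $c$ public coins obtaining $z\in\{0,1\}^c$; then, given $y$ and $z$, Bob sends Alice $c$ bits, using an unlimited supply of private (not public) random coins, and Alice decides to accept or reject. Requirements: if $F(x,y)=1$, then for at least half of the strings $z\in\{0,1\}^c$ Alice accepts with probability $>1/2$; if $F(x,y)=0$, then for every $z\in\{0,1\}^c$ Alice accepts with probability $<1/2$. *)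

theory Defs
  imports "HOL-Probability.Probability" "HOL-Library.Landau_Symbols"
begin

definition bits :: "nat \<Rightarrow> bool list set" where
  "bits n = {z. length z = n}"

definition THR :: "real list \<Rightarrow> real \<Rightarrow> bool list \<Rightarrow> bool" where
  "THR w t z \<longleftrightarrow> t \<le> (\<Sum>i<length z. w ! i * of_bool (z ! i))"

record thr_thr =
  bottom :: "(real list \<times> real) list"
  top_weights :: "real list"
  top_threshold :: real

definition thr_thr_wf :: "nat \<Rightarrow> thr_thr \<Rightarrow> bool" where
  "thr_thr_wf N C \<longleftrightarrow>
     length (top_weights C) = length (bottom C) \<and>
     (\<forall>(w, t) \<in> set (bottom C). length w = N)"

definition thr_thr_eval :: "thr_thr \<Rightarrow> bool list \<Rightarrow> bool" where
  "thr_thr_eval C z =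
     THR (top_weights C) (top_threshold C) (map (\<lambda>(w, t). THR w t z) (bottom C))"

text \<open>
  Size is the number of nodes of the circuit: the bottom gates, the top gate, and the input
  variables that are wired (with nonzero weight) to some bottom gate. Input nodes have to be
  counted for a bound depending on the size alone: ``greater than'' on \<open>n\<close>-bit numbers is a single
  threshold gate, but its communication matrix has \<open>2 ^ n\<close> distinct rows, while in the protocols
  below Alice has at most \<open>2 ^ 2 ^ (2 * c)\<close> different strategies.
\<close>

definition thr_thr_size :: "nat \<Rightarrow> thr_thr \<Rightarrow> nat" where
  "thr_thr_size N C =
     card {i. i < N \<and> (\<exists>(w, t) \<in> set (bottom C). w ! i \<noteq> 0)} + length (bottom C) + 1"

definition computed_by_thr_thr ::
    "nat \<Rightarrow> (bool list \<Rightarrow> bool list \<Rightarrow> bool) \<Rightarrow> nat \<Rightarrow> bool" where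
  "computed_by_thr_thr n F s \<longleftrightarrow>
     (\<exists>C. thr_thr_wf (2 * n) C \<and> thr_thr_size (2 * n) C = s \<and>
          (\<forall>x \<in> bits n. \<forall>y \<in> bits n. thr_thr_eval C (x @ y) = F x y))"

text \<open>
  \<open>bob y z r\<close> is Bob's message on input \<open>y\<close>, public coins \<open>z\<close> and private coins \<open>r\<close>. The number \<open>k\<close>
  of private coins is not charged to the cost.
\<close>

definition accept_prob ::
    "nat \<Rightarrow> (bool list \<Rightarrow> bool list \<Rightarrow> bool list \<Rightarrow> bool list) \<Rightarrow>
     (bool list \<Rightarrow> bool list \<Rightarrow> bool list \<Rightarrow> bool) \<Rightarrow>
     bool list \<Rightarrow> bool list \<Rightarrow> bool list \<Rightarrow> real" where
  "accept_prob k bob alice x y z =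
     measure_pmf.prob (pmf_of_set (bits k)) {r. alice x z (bob y z r)}"

definition has_RP_UPP_protocol ::
    "nat \<Rightarrow> (bool list \<Rightarrow> bool list \<Rightarrow> bool) \<Rightarrow> nat \<Rightarrow> bool" where
  "has_RP_UPP_protocol n F c \<longleftrightarrow>
     (\<exists>k bob alice.
        (\<forall>y \<in> bits n. \<forall>z \<in> bits c. \<forall>r \<in> bits k. bob y z r \<in> bits c) \<and>
        (\<forall>x \<in> bits n. \<forall>y \<in> bits n.
           (F x y \<longrightarrow>
              real (card {z \<in> bits c. accept_prob k bob alice x y z > 1 / 2})
                \<ge> real (card (bits c)) / 2) \<and>
           (\<not> F x y \<longrightarrow>
              (\<forall>z \<in> bits c. accept_prob k bob alice x y z < 1 / 2))))"

end

theory Submission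
  imports Defs "HOL-Real_Asymp.Real_Asymp"
begin

text \<open>
  Whether a bottom gate fires depends only on how a number known to Alice compares with one known to
  Bob. After replacing both numbers by ranks, they have at most \<open>s\<close> bits, and the comparison is a
  sum of at most \<open>s\<close> equality tests. Complementing the gates whose top weight is positive turns the
  circuit into the condition \<open>\<Sum> a\<^sub>i [f\<^sub>i(x) = g\<^sub>i(y)] \<le> \<tau>\<close> with all \<open>a\<^sub>i \<ge> 0\<close>. Now hash both sides of
  every equality test with public coins. Collisions can only increase the left-hand side, so inputs
  with \<open>F x y = 0\<close> are rejected for all coins, while for most coins there is no collision at all.
  For the hashed tests Bob samples \<open>i\<close> with probability proportional to \<open>a\<^sub>i\<close> and sends it with
  the hash value of \<open>g\<^sub>i(y)\<close>. The hash family is a code of large distance found greedily as in the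
  Gilbert--Varshamov bound.
\<close>

section \<open>Counting bit strings\<close>

lemma finite_bits [simp]: "finite (bits n)"
  using finite_lists_length_eq[of "UNIV :: bool set" n] by (simp add: bits_def)

lemma card_bits: "card (bits n) = 2 ^ n"
  using card_lists_length_eq[of "UNIV :: bool set" n] by (simp add: bits_def)

lemma bits_nonempty [simp]: "bits n \<noteq> {}"
  using card_bits[of n] by fastforce

text \<open>Each prefix of length \<open>m\<close> has \<open>2 ^ d\<close> extensions. The cost
  bounds both coins and message, so the protocol tosses more public coins than the hash reads; this
  transfers counts of hash seeds to counts of full coin strings.\<close>

lemma card_bits_take:
  "card {z \<in> bits (m + d). P (take m z)} = card {z \<in> bits m. P z} * 2 ^ d"
proof -
  have "bij_betw (\<lambda>(u, v). u @ v) ({z \<in> bits m. P z} \<times> bits d) {z \<in> bits (m + d). P (take m z)}"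
    by (rule bij_betw_byWitness[where f' = "\<lambda>z. (take m z, drop m z)"]) (auto simp: bits_def)
  from bij_betw_same_card[OF this] show ?thesis
    by (simp add: card_cartesian_product card_bits)
qed

section \<open>Threshold gates as sums of equality tests\<close>

text \<open>Ranks count strictly smaller elements: if \<open>u < v\<close>, then \<open>u\<close>
  itself is counted for \<open>v\<close> but not for \<open>u\<close>. Only \<open>u\<close> must
  lie in \<open>U\<close>, so Bob's number can be ranked among the possible values of
  Alice's.\<close>

lemma le_iff_rank_le:
  fixes u v :: "'a :: linorder"
  assumes "finite U" "u \<in> U"
  shows "v \<le> u \<longleftrightarrow> card {a \<in> U. a < v} \<le> card {a \<in> U. a < u}"
proof
  assume "v \<le> u"
  then show "card {a \<in> U. a < v} \<le> card {a \<in> U. a < u}"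
    using assms by (intro card_mono) auto
next
  assume le: "card {a \<in> U. a < v} \<le> card {a \<in> U. a < u}"
  show "v \<le> u"
  proof (rule ccontr)
    assume "\<not> v \<le> u"
    then have "u < v" by simp
    then have "{a \<in> U. a < u} \<subseteq> {a \<in> U. a < v}" "u \<in> {a \<in> U. a < v}"
      using assms by auto
    then have "{a \<in> U. a < u} \<subset> {a \<in> U. a < v}"
      by blast
    then have "card {a \<in> U. a < u} < card {a \<in> U. a < v}"
      using assms by (intro psubset_card_mono) auto
    with le show False by simp
  qed
qed

lemma THR_append:
  assumes "length x = n" "length y = n"
  shows "THR w t (x @ y) \<longleftrightarrow>
    t - (\<Sum>i<n. w ! (n + i) * of_bool (y ! i)) \<le> (\<Sum>i<n. w ! i * of_bool (x ! i))"
proof -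
  have "(\<Sum>i<n + n. w ! i * of_bool ((x @ y) ! i)) =
      (\<Sum>i<n. w ! i * of_bool ((x @ y) ! i)) + (\<Sum>i=n..<n+n. w ! i * of_bool ((x @ y) ! i))"
    unfolding lessThan_atLeast0 by (rule sum.atLeastLessThan_concat[symmetric]) auto
  also have "(\<Sum>i=n..<n+n. w ! i * of_bool ((x @ y) ! i)) = (\<Sum>i<n. w ! (n + i) * of_bool (y ! i))"
    by (rule sum.reindex_bij_witness[where i = "\<lambda>i. n + i" and j = "\<lambda>i. i - n"])
      (use assms in \<open>auto simp: nth_append\<close>)
  also have "(\<Sum>i<n. w ! i * of_bool ((x @ y) ! i)) = (\<Sum>i<n. w ! i * of_bool (x ! i))"
    using assms by (intro sum.cong) (auto simp: nth_append)
  finally show ?thesis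
    using assms by (auto simp: THR_def)
qed

text \<open>Alice's part of the weighted sum is a subset sum of at most \<open>m\<close> nonzero
  weights, hence takes at most \<open>2 ^ m\<close> values. Bob's number is ranked among these
  values and may exceed all of them, so its bound is not strict.\<close>

lemma THR_append_as_comparison:
  assumes "card {i. i < n \<and> w ! i \<noteq> 0} \<le> m"
  obtains V R :: "bool list \<Rightarrow> nat"
  where "\<And>x y. x \<in> bits n \<Longrightarrow> y \<in> bits n \<Longrightarrow> THR w t (x @ y) \<longleftrightarrow> V y \<le> R x"
    and "\<And>x. x \<in> bits n \<Longrightarrow> R x < 2 ^ m" and "\<And>y. V y \<le> 2 ^ m"
proof
  define u :: "bool list \<Rightarrow> real" where "u x = (\<Sum>i<n. w ! i * of_bool (x ! i))" for x
  define v :: "bool list \<Rightarrow> real" where "v y = t - (\<Sum>i<n. w ! (n + i) * of_bool (y ! i))" for y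
  define U where "U = u ` bits n"
  have fin: "finite U" by (simp add: U_def)
  let ?D = "{i. i < n \<and> w ! i \<noteq> 0}"
  have "u x = (\<Sum>i\<in>{i \<in> ?D. x ! i}. w ! i)" for x
    unfolding u_def by (rule sum.mono_neutral_cong_right) auto
  then have "U \<subseteq> (\<lambda>S. \<Sum>i\<in>S. w ! i) ` Pow ?D"
    unfolding U_def by blast
  then have "card U \<le> card (Pow ?D)"
    by (intro surj_card_le) auto
  also have "\<dots> \<le> 2 ^ m"
    using assms by (simp add: card_Pow)
  finally have U: "card U \<le> 2 ^ m" .
  show "THR w t (x @ y) \<longleftrightarrow> card {a \<in> U. a < v y} \<le> card {a \<in> U. a < u x}"
    if "x \<in> bits n" "y \<in> bits n" for x y
    using that le_iff_rank_le[OF fin, of "u x" "v y"] THR_append[of x n y w t]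
    by (auto simp: bits_def u_def v_def U_def)
  show "card {a \<in> U. a < u x} < 2 ^ m" if "x \<in> bits n" for x
  proof -
    have "card {a \<in> U. a < u x} < card U"
      using fin that by (intro psubset_card_mono) (auto simp: U_def)
    with U show ?thesis by simp
  qed
  show "card {a \<in> U. a < v y} \<le> 2 ^ m" for y
    using card_mono[OF fin, of "{a \<in> U. a < v y}"] U by auto
qed

text \<open>If \<open>p < q\<close>, exactly one summand is 1, at the highest bit where
  \<open>p\<close> and \<open>q\<close> differ: there the binary prefixes are siblings, with
  \<open>p\<close> on the left. Otherwise no level qualifies. The induction strips the lowest
  bit.\<close>

lemma of_bool_less_eq_sum_bits:
  fixes p q :: nat
  assumes "p < 2 ^ s" "q < 2 ^ s"
  shows "of_bool (p < q) =
    (\<Sum>j<s. of_bool (even (p div 2 ^ j) \<and> q div 2 ^ j = Suc (p div 2 ^ j)) :: real)"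
  using assms
proof (induction s arbitrary: p q)
  case (Suc s)
  have "(\<Sum>j<Suc s. of_bool (even (p div 2 ^ j) \<and> q div 2 ^ j = Suc (p div 2 ^ j)) :: real) =
      of_bool (even p \<and> q = Suc p) + of_bool (p div 2 < q div 2)"
    using Suc.prems
    by (subst sum.lessThan_Suc_shift, subst Suc.IH) (auto simp: div_mult2_eq)
  also have "\<dots> = of_bool (p < q)"
  proof -
    have "p < q \<longleftrightarrow> (even p \<and> q = Suc p) \<or> p div 2 < q div 2"
      by presburger
    moreover have "\<not> ((even p \<and> q = Suc p) \<and> p div 2 < q div 2)"
      by presburger
    ultimately show ?thesis by (auto simp del: even_Suc)
  qed
  finally show ?case ..
qed auto

text \<open>
  The values \<open>2 ^ s\<close> and \<open>Suc (2 ^ s)\<close> are sentinels that are never equal to the other side.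
\<close>

definition lower_key :: "nat \<Rightarrow> nat \<Rightarrow> nat \<Rightarrow> nat" where
  "lower_key s j p = (if even (p div 2 ^ j) then p div 2 ^ j else 2 ^ s)"

definition upper_key :: "nat \<Rightarrow> nat \<Rightarrow> nat \<Rightarrow> nat" where
  "upper_key s j q = (if odd (q div 2 ^ j) then q div 2 ^ j - 1 else Suc (2 ^ s))"

lemma div_power_less: "p < 2 ^ s \<Longrightarrow> p div 2 ^ j < (2 ^ s :: nat)"
  by (meson div_le_dividend le_less_trans)

lemma lower_key_less: "p < 2 ^ s \<Longrightarrow> lower_key s j p < 2 ^ (s + 2)"
  using div_power_less[of p s j] by (auto simp: lower_key_def)

text \<open>Two extra bits leave room for the sentinel even if \<open>s = 0\<close>, where
  \<open>Suc (2 ^ s)\<close> is 2.\<close>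

lemma upper_key_less: "q < 2 ^ s \<Longrightarrow> upper_key s j q < 2 ^ (s + 2)"
  using div_power_less[of q s j] one_le_power[of "2::nat" s] by (auto simp: upper_key_def)

text \<open>A number that succeeds an even number is odd, so each side can check the parity of its
  own prefix. What remains is an equality between two locally computed keys.\<close>

lemma of_bool_less_eq_sum_keys:
  assumes "p < 2 ^ s" "q < 2 ^ s"
  shows "of_bool (p < q) = (\<Sum>j<s. of_bool (lower_key s j p = upper_key s j q) :: real)"
  unfolding of_bool_less_eq_sum_bits[OF assms]
proof (rule sum.cong[OF refl])
  fix j
  have "p div 2 ^ j < 2 ^ s" "q div 2 ^ j < 2 ^ s"
    using assms div_power_less by auto
  then have "even (p div 2 ^ j) \<and> q div 2 ^ j = Suc (p div 2 ^ j) \<longleftrightarrow>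
      lower_key s j p = upper_key s j q"
    unfolding lower_key_def upper_key_def
    by (cases "q div 2 ^ j") auto
  then show "(of_bool (even (p div 2 ^ j) \<and> q div 2 ^ j = Suc (p div 2 ^ j)) :: real) =
      of_bool (lower_key s j p = upper_key s j q)"
    by simp
qed

text \<open>The flag \<open>b\<close> selects the gate or its complement: the gate fires iff
  \<open>V y < Suc (R x)\<close>, and fails iff \<open>R x < V y\<close>. Both are strict
  comparisons, with Alice on the larger side in the first and on the smaller side in the
  second.\<close>

lemma THR_as_equality_tests:
  assumes "card {i. i < n \<and> w ! i \<noteq> 0} < s"
  shows "\<exists>f g :: nat \<Rightarrow> bool list \<Rightarrow> nat.
    (\<forall>j. \<forall>x\<in>bits n. f j x < 2 ^ (s + 2) \<and> g j x < 2 ^ (s + 2)) \<and>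
    (\<forall>x\<in>bits n. \<forall>y\<in>bits n.
       of_bool (THR w t (x @ y) = b) = (\<Sum>j<s. of_bool (f j x = g j y) :: real))"
proof -
  obtain m where m: "s = Suc m" using assms by (cases s) auto
  then have few: "card {i. i < n \<and> w ! i \<noteq> 0} \<le> m" using assms by simp
  obtain V R :: "bool list \<Rightarrow> nat" where RV:
    "\<And>x y. x \<in> bits n \<Longrightarrow> y \<in> bits n \<Longrightarrow> THR w t (x @ y) \<longleftrightarrow> V y \<le> R x"
    "\<And>x. x \<in> bits n \<Longrightarrow> R x < 2 ^ m" "\<And>y. V y \<le> 2 ^ m"
    by (fact THR_append_as_comparison[OF few])
  \<comment> \<open>The strict bound on the number of wired inputs supplies a spare bit, which holds
    both the successor of \<open>R x\<close> and the extreme value \<open>2 ^ m\<close> of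
    \<open>V y\<close>.\<close>
  have R: "Suc (R x) < 2 ^ s" "R x < 2 ^ s" if "x \<in> bits n" for x
    using RV(2)[OF that] m one_le_power[of "2::nat" m] by auto
  have V: "V y < 2 ^ s" for y
    using RV(3)[of y] m by (simp add: le_less_trans)
  show ?thesis
  proof (cases b)
    case True
    have "of_bool (THR w t (x @ y) = b) =
        (\<Sum>j<s. of_bool (upper_key s j (Suc (R x)) = lower_key s j (V y)) :: real)"
      if "x \<in> bits n" "y \<in> bits n" for x y
      using of_bool_less_eq_sum_keys[OF V R(1)[OF that(1)], of y] RV(1)[OF that] True
      by (simp add: less_Suc_eq_le eq_commute)
    then show ?thesis
      by - (rule exI[of _ "\<lambda>j x. upper_key s j (Suc (R x))"], rule exI[of _ "\<lambda>j y. lower_key s j (V y)"],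
        blast intro: R V upper_key_less lower_key_less)
  next
    case False
    have "of_bool (THR w t (x @ y) = b) =
        (\<Sum>j<s. of_bool (lower_key s j (R x) = upper_key s j (V y)) :: real)"
      if "x \<in> bits n" "y \<in> bits n" for x y
      using of_bool_less_eq_sum_keys[OF R(2)[OF that(1)] V, of y] RV(1)[OF that] False
      by (simp add: not_le)
    then show ?thesis
      by - (rule exI[of _ "\<lambda>j x. lower_key s j (R x)"], rule exI[of _ "\<lambda>j y. upper_key s j (V y)"],
        blast intro: R V upper_key_less lower_key_less)
  qed
qed

lemma thr_thr_as_equality_tests:
  assumes "computed_by_thr_thr n F s"
  obtains I :: "(nat \<times> nat) set" and a :: "nat \<times> nat \<Rightarrow> real"
    and f g :: "nat \<times> nat \<Rightarrow> bool list \<Rightarrow> nat" and \<tau> :: real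
  where "finite I" "card I \<le> s * s" "\<And>i. a i \<ge> 0"
    "\<And>i x. i \<in> I \<Longrightarrow> x \<in> bits n \<Longrightarrow> f i x < 2 ^ (s + 2) \<and> g i x < 2 ^ (s + 2)"
    "\<And>x y. x \<in> bits n \<Longrightarrow> y \<in> bits n \<Longrightarrow>
       F x y \<longleftrightarrow> (\<Sum>i\<in>{i \<in> I. f i x = g i y}. a i) \<le> \<tau>"
proof -
  obtain C where C: "thr_thr_wf (2 * n) C" "thr_thr_size (2 * n) C = s"
    "\<And>x y. x \<in> bits n \<Longrightarrow> y \<in> bits n \<Longrightarrow> thr_thr_eval C (x @ y) = F x y"
    using assms by (auto simp: computed_by_thr_thr_def)
  define B where "B = length (bottom C)"
  define W where "W k = top_weights C ! k" for k
  define T where "T k z = THR (fst (bottom C ! k)) (snd (bottom C ! k)) z" for k z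
  have B: "B \<le> s" using C(2) by (simp add: thr_thr_size_def B_def)
  \<comment> \<open>The size also counts the top gate, so the number of wired inputs is strictly
    below \<open>s\<close>.\<close>
  have few_inputs: "card {i. i < n \<and> fst (bottom C ! k) ! i \<noteq> 0} < s" if "k < B" for k
  proof -
    have "bottom C ! k \<in> set (bottom C)" using that by (simp add: B_def)
    then have "card {i. i < n \<and> fst (bottom C ! k) ! i \<noteq> 0} \<le>
        card {i. i < 2 * n \<and> (\<exists>(w, t) \<in> set (bottom C). w ! i \<noteq> 0)}"
      by (intro card_mono) (auto split: prod.splits intro!: bexI[of _ "bottom C ! k"])
    then show ?thesis using C(2) by (simp add: thr_thr_size_def)
  qed
  define Q where "Q k f g \<longleftrightarrow>
    (\<forall>j. \<forall>x\<in>bits n. f j x < 2 ^ (s + 2) \<and> g j x < 2 ^ (s + 2)) \<and>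
    (\<forall>x\<in>bits n. \<forall>y\<in>bits n.
       of_bool (T k (x @ y) = (W k < 0)) = (\<Sum>j<s. of_bool (f j x = g j y) :: real))"
    for k and f g :: "nat \<Rightarrow> bool list \<Rightarrow> nat"
  have "\<exists>f g. Q k f g" if "k < B" for k
    unfolding Q_def T_def by (rule THR_as_equality_tests[OF few_inputs[OF that]])
  then obtain f g where Q: "\<And>k. k < B \<Longrightarrow> Q k (f k) (g k)"
    by metis
  have fg:
    "\<And>k j x. k < B \<Longrightarrow> x \<in> bits n \<Longrightarrow> f k j x < 2 ^ (s + 2) \<and> g k j x < 2 ^ (s + 2)"
    "\<And>k x y. k < B \<Longrightarrow> x \<in> bits n \<Longrightarrow> y \<in> bits n \<Longrightarrow>
      of_bool (T k (x @ y) = (W k < 0)) = (\<Sum>j<s. of_bool (f k j x = g k j y) :: real)"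
    using Q unfolding Q_def by blast+
  define P where "P = (\<Sum>k<B. max (W k) 0)"
  define t where "t = top_threshold C"
  show ?thesis
  proof (rule that[of "{..<B} \<times> {..<s}" "\<lambda>(k, j). \<bar>W k\<bar>" "\<lambda>(k, j). f k j" "\<lambda>(k, j). g k j" "P - t"])
    show "card ({..<B} \<times> {..<s}) \<le> s * s" using B by (simp add: card_cartesian_product)
    fix x y assume xy: "x \<in> bits n" "y \<in> bits n"
    have "F x y \<longleftrightarrow> t \<le> (\<Sum>k<B. W k * of_bool (T k (x @ y)))"
      unfolding C(3)[OF xy, symmetric] thr_thr_eval_def THR_def[of "top_weights C"]
      by (simp add: B_def W_def T_def t_def split_beta)
    \<comment> \<open>A nonnegative weight is rewritten as a constant minus a penalty when the gate
      does not fire; a negative weight is already a penalty when it fires. The constants add up to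
      \<open>P\<close>, giving the threshold \<open>P - t\<close>.\<close>
    also have "(\<Sum>k<B. W k * of_bool (T k (x @ y))) =
        (\<Sum>k<B. max (W k) 0 - \<bar>W k\<bar> * of_bool (T k (x @ y) = (W k < 0)))"
      by (intro sum.cong) auto
    also have "\<dots> = P - (\<Sum>k<B. \<bar>W k\<bar> * (\<Sum>j<s. of_bool (f k j x = g k j y)))"
      using fg(2) xy by (simp add: P_def sum_subtractf)
    also have "(\<Sum>k<B. \<bar>W k\<bar> * (\<Sum>j<s. of_bool (f k j x = g k j y))) =
        (\<Sum>(k, j)\<in>{..<B} \<times> {..<s}. \<bar>W k\<bar> * of_bool (f k j x = g k j y))"
      by (simp only: sum.cartesian_product sum_distrib_left)
    also have "\<dots> = (\<Sum>i\<in>{i \<in> {..<B} \<times> {..<s}. (case i of (k, j) \<Rightarrow> f k j) x = (case i of (k, j) \<Rightarrow> g k j) y}.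
        case i of (k, j) \<Rightarrow> \<bar>W k\<bar>)"
      by (rule sum.mono_neutral_cong_right) auto
    finally show "F x y \<longleftrightarrow> (\<Sum>i\<in>{i \<in> {..<B} \<times> {..<s}. (case i of (k, j) \<Rightarrow> f k j) x = (case i of (k, j) \<Rightarrow> g k j) y}.
        case i of (k, j) \<Rightarrow> \<bar>W k\<bar>) \<le> P - t"
      by linarith
  qed (use fg(1) in auto)
qed

section \<open>Hashing by a greedy code\<close>

lemma card_words_agreeing_on:
  assumes "finite Z" "S \<subseteq> Z" "\<And>z. z \<in> Z \<Longrightarrow> u z < q"
  shows "card {w \<in> Z \<rightarrow>\<^sub>E {..<q::nat}. \<forall>z\<in>S. w z = u z} = q ^ (card Z - card S)"
proof -
  have "{w \<in> Z \<rightarrow>\<^sub>E {..<q}. \<forall>z\<in>S. w z = u z} = (\<Pi>\<^sub>E z\<in>Z. if z \<in> S then {u z} else {..<q})"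
    (is "?A = ?B")
  proof (intro subset_antisym subsetI)
    show "w \<in> ?B" if "w \<in> ?A" for w
      using that by (simp add: PiE_iff)
  next
    fix w assume w: "w \<in> ?B"
    have "w z < q" if "z \<in> Z" for z
      using PiE_mem[OF w that] assms(3)[OF that] by (cases "z \<in> S") auto
    moreover have "w z = u z" if "z \<in> S" for z
      using PiE_mem[OF w, of z] that assms(2) by auto
    ultimately show "w \<in> ?A"
      using w by (auto simp: PiE_iff)
  qed
  then have "card {w \<in> Z \<rightarrow>\<^sub>E {..<q}. \<forall>z\<in>S. w z = u z} = (\<Prod>z\<in>Z. if z \<in> S then 1 else q)"
    by (simp add: card_PiE[OF assms(1)] if_distrib cong: if_cong)
  also have "\<dots> = (\<Prod>z\<in>Z - S. q)"
    by (rule prod.mono_neutral_cong_right) (use assms in auto)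
  also have "\<dots> = q ^ (card Z - card S)"
    using assms by (simp add: card_Diff_subset finite_subset)
  finally show ?thesis .
qed

text \<open>Union bound over the sets of \<open>r\<close> positions on which the two words agree,
  with the binomial coefficient bounded by a power.\<close>

lemma card_words_agreeing_often:
  assumes "finite Z" "\<And>z. z \<in> Z \<Longrightarrow> u z < q"
  shows "card {w \<in> Z \<rightarrow>\<^sub>E {..<q::nat}. r \<le> card {z \<in> Z. w z = u z}} \<le>
    card Z ^ r * q ^ (card Z - r)"
proof -
  let ?K = "{S. S \<subseteq> Z \<and> card S = r}"
  let ?A = "\<lambda>S. {w \<in> Z \<rightarrow>\<^sub>E {..<q}. \<forall>z\<in>S. w z = u z}"
  have finK: "finite ?K" using assms(1) by simp
  have finW: "finite (Z \<rightarrow>\<^sub>E {..<q})" using assms(1) by (simp add: finite_PiE)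
  have "{w \<in> Z \<rightarrow>\<^sub>E {..<q}. r \<le> card {z \<in> Z. w z = u z}} \<subseteq> (\<Union>S\<in>?K. ?A S)"
  proof
    fix w assume w: "w \<in> {w \<in> Z \<rightarrow>\<^sub>E {..<q}. r \<le> card {z \<in> Z. w z = u z}}"
    then obtain S where "S \<subseteq> {z \<in> Z. w z = u z}" "card S = r"
      by (auto elim: obtain_subset_with_card_n)
    with w show "w \<in> (\<Union>S\<in>?K. ?A S)" by blast
  qed
  then have "card {w \<in> Z \<rightarrow>\<^sub>E {..<q}. r \<le> card {z \<in> Z. w z = u z}} \<le> card (\<Union>S\<in>?K. ?A S)"
    using finK finW by (intro card_mono) auto
  also have "\<dots> \<le> (\<Sum>S\<in>?K. card (?A S))"
    using finK by (rule card_UN_le)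
  also have "\<dots> = (\<Sum>S\<in>?K. q ^ (card Z - r))"
    using assms by (intro sum.cong) (auto simp: card_words_agreeing_on)
  also have "\<dots> = (card Z choose r) * q ^ (card Z - r)"
    using n_subsets[OF assms(1)] by simp
  also have "\<dots> \<le> card Z ^ r * q ^ (card Z - r)"
    by (cases "r \<le> card Z") (auto simp: binomial_le_pow binomial_eq_0)
  finally show ?thesis .
qed

text \<open>Keys index code words and seeds index coordinates, so large distance means few colliding
  seeds. Each earlier word excludes at most \<open>card Z ^ Suc L * q ^ (card Z - Suc L)\<close>
  candidates. As \<open>q = 2 * card Z\<close>, it takes \<open>2 ^ Suc L\<close> such words to
  exhaust the bound \<open>q ^ card Z\<close>, and there are fewer. The condition
  \<open>L < card Z\<close> keeps the subtraction from truncating.\<close>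

lemma greedy_code:
  assumes "finite Z" "Z \<noteq> {}" "m \<le> 2 ^ L" "L < card Z" and q: "q = 2 * card Z"
  shows "\<exists>h :: nat \<Rightarrow> 'a \<Rightarrow> nat. (\<forall>j<m. h j \<in> Z \<rightarrow>\<^sub>E {..<q}) \<and>
    (\<forall>i<m. \<forall>j<m. i \<noteq> j \<longrightarrow> card {z \<in> Z. h i z = h j z} < Suc L)"
  using assms(3)
proof (induction m)
  case (Suc m)
  then obtain h :: "nat \<Rightarrow> 'a \<Rightarrow> nat" where "(\<forall>j<m. h j \<in> Z \<rightarrow>\<^sub>E {..<q}) \<and>
    (\<forall>i<m. \<forall>j<m. i \<noteq> j \<longrightarrow> card {z \<in> Z. h i z = h j z} < Suc L)"
    using Suc_leD by blast
  then have h: "\<And>j. j < m \<Longrightarrow> h j \<in> Z \<rightarrow>\<^sub>E {..<q}"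
    "\<And>i j. i < m \<Longrightarrow> j < m \<Longrightarrow> i \<noteq> j \<Longrightarrow> card {z \<in> Z. h i z = h j z} < Suc L"
    by blast+
  let ?W = "Z \<rightarrow>\<^sub>E {..<q}"
  let ?bad = "\<lambda>j. {w \<in> ?W. Suc L \<le> card {z \<in> Z. w z = h j z}}"
  have finW: "finite ?W" using assms(1) by (simp add: finite_PiE)
  have pos: "card Z > 0" using assms by (simp add: card_gt_0_iff)
  have "card (\<Union>j<m. ?bad j) \<le> (\<Sum>j<m. card (?bad j))"
    by (rule card_UN_le) simp
  also have "\<dots> \<le> (\<Sum>j<m. card Z ^ Suc L * q ^ (card Z - Suc L))"
    using h(1) by (intro sum_mono card_words_agreeing_often assms) auto
  also have "\<dots> = m * (card Z ^ Suc L * q ^ (card Z - Suc L))"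
    by simp
  also have "\<dots> < 2 ^ Suc L * (card Z ^ Suc L * q ^ (card Z - Suc L))"
    using Suc.prems pos q by (intro mult_strict_right_mono) auto
  also have "\<dots> = q ^ Suc L * q ^ (card Z - Suc L)"
    by (simp add: q power_mult_distrib)
  also have "\<dots> = q ^ card Z"
    using assms(4) by (metis Suc_leI le_add_diff_inverse power_add)
  also have "\<dots> = card ?W"
    using assms(1) by (simp add: card_PiE)
  finally have "card (\<Union>j<m. ?bad j) < card ?W" .
  then have "\<not> ?W \<subseteq> (\<Union>j<m. ?bad j)"
    using finW card_mono[of "\<Union>j<m. ?bad j" ?W] by auto
  then obtain w where w: "w \<in> ?W" "\<And>j. j < m \<Longrightarrow> card {z \<in> Z. w z = h j z} < Suc L"
    by force
  have "card {z \<in> Z. h j z = w z} < Suc L" if "j < m" for j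
    using w(2)[OF that] by (simp add: eq_commute)
  then show ?case
    using h w by (intro exI[of _ "h(m := w)"]) (auto simp: less_Suc_eq)
qed auto

section \<open>Integer weights and sampling\<close>

text \<open>Finitely many subset sums leave a gap above \<tau>. Scaling by a large \<open>K\<close>
  makes this gap exceed the total rounding loss, which is at most \<open>card I\<close>. Both
  inequalities are strict because acceptance probability 1/2 is never allowed.\<close>

lemma integer_threshold_weights:
  fixes a :: "'i \<Rightarrow> real"
  assumes "finite I" "\<And>i. a i \<ge> 0"
  obtains N :: "'i \<Rightarrow> nat" and \<theta> :: int
  where "\<And>S. S \<subseteq> I \<Longrightarrow> (\<Sum>i\<in>S. a i) \<le> \<tau> \<Longrightarrow> int (\<Sum>i\<in>S. N i) < \<theta>"
    and "\<And>S. S \<subseteq> I \<Longrightarrow> (\<Sum>i\<in>S. a i) > \<tau> \<Longrightarrow> int (\<Sum>i\<in>S. N i) > \<theta>"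
proof -
  define G where "G = (\<lambda>S. (\<Sum>i\<in>S. a i) - \<tau>) ` {S. S \<subseteq> I \<and> (\<Sum>i\<in>S. a i) > \<tau>}"
  \<comment> \<open>The extra 1 keeps the minimum defined and positive when no subset sum exceeds
    \<tau>.\<close>
  define \<eta> where "\<eta> = Min (insert 1 G)"
  have finG: "finite G" using assms(1) by (simp add: G_def)
  then have "\<eta> > 0" by (auto simp: \<eta>_def G_def)
  have \<eta>: "\<eta> \<le> (\<Sum>i\<in>S. a i) - \<tau>" if "S \<subseteq> I" "(\<Sum>i\<in>S. a i) > \<tau>" for S
    unfolding \<eta>_def using that finG by (intro Min_le) (auto simp: G_def)
  \<comment> \<open>After rounding, a sum is either at most \<open>real K * \<tau>\<close> or more
    than 3 above it; this separates the two cases around \<theta>, the floor plus 2.\<close>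
  obtain K :: nat where K: "real K * \<eta> > real (card I) + 3"
    using \<open>\<eta> > 0\<close> reals_Archimedean3 by blast
  define N where "N i = nat \<lfloor>real K * a i\<rfloor>" for i
  define \<theta> where "\<theta> = \<lfloor>real K * \<tau>\<rfloor> + 2"
  have N: "real (N i) \<le> real K * a i" "real K * a i \<le> real (N i) + 1" for i
    using assms(2)[of i] by (auto simp: N_def)
  show ?thesis
  proof (rule that)
    fix S assume S: "S \<subseteq> I"
    have fin: "finite S" using S assms(1) finite_subset by blast
    have up: "real (\<Sum>i\<in>S. N i) \<le> real K * (\<Sum>i\<in>S. a i)"
      unfolding of_nat_sum sum_distrib_left by (intro sum_mono N)
    have "real K * (\<Sum>i\<in>S. a i) \<le> (\<Sum>i\<in>S. real (N i) + 1)"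
      unfolding sum_distrib_left by (intro sum_mono N)
    also have "\<dots> \<le> real (\<Sum>i\<in>S. N i) + real (card I)"
      using card_mono[OF assms(1) S] by (simp add: sum.distrib)
    finally have low: "real K * (\<Sum>i\<in>S. a i) \<le> real (\<Sum>i\<in>S. N i) + real (card I)" .
    show "int (\<Sum>i\<in>S. N i) < \<theta>" if "(\<Sum>i\<in>S. a i) \<le> \<tau>"
    proof -
      have "real K * (\<Sum>i\<in>S. a i) \<le> real K * \<tau>"
        using that by (intro mult_left_mono) auto
      with up show ?thesis unfolding \<theta>_def by linarith
    qed
    show "int (\<Sum>i\<in>S. N i) > \<theta>" if "(\<Sum>i\<in>S. a i) > \<tau>"
    proof -
      have "real K * \<eta> \<le> real K * ((\<Sum>i\<in>S. a i) - \<tau>)"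
        using \<eta>[OF S that] by (intro mult_left_mono) auto
      then have "real K * \<tau> + real K * \<eta> \<le> real K * (\<Sum>i\<in>S. a i)"
        by (simp add: algebra_simps)
      with low K show ?thesis unfolding \<theta>_def by linarith
    qed
  qed
qed

text \<open>Uniform coin strings are matched bijectively with blocks of sizes \<open>N j\<close>, so
  outcome \<open>j\<close> gets probability \<open>N j / 2 ^ k\<close> exactly.\<close>

lemma sampler_with_counts:
  fixes N :: "'j \<Rightarrow> nat"
  assumes "finite J" "(\<Sum>j\<in>J. N j) = 2 ^ k"
  obtains smp where "\<And>r. r \<in> bits k \<Longrightarrow> smp r \<in> J"
    "\<And>S. S \<subseteq> J \<Longrightarrow> card {r \<in> bits k. smp r \<in> S} = (\<Sum>j\<in>S. N j)"
proof -
  have "card (bits k) = card (SIGMA j:J. {..<N j})"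
    using assms by (simp add: card_bits)
  then obtain \<phi> where \<phi>: "bij_betw \<phi> (bits k) (SIGMA j:J. {..<N j})"
    using assms(1) by (meson finite_SigmaI finite_bits finite_lessThan finite_same_card_bij)
  show ?thesis
  proof (rule that[of "fst \<circ> \<phi>"])
    show "(fst \<circ> \<phi>) r \<in> J" if "r \<in> bits k" for r
      using bij_betwE[OF \<phi>] that by auto
    fix S assume S: "S \<subseteq> J"
    have "\<phi> ` {r \<in> bits k. (fst \<circ> \<phi>) r \<in> S} = (SIGMA j:S. {..<N j})"
    proof
      show "\<phi> ` {r \<in> bits k. (fst \<circ> \<phi>) r \<in> S} \<subseteq> (SIGMA j:S. {..<N j})"
        using bij_betwE[OF \<phi>] by fastforce
      show "(SIGMA j:S. {..<N j}) \<subseteq> \<phi> ` {r \<in> bits k. (fst \<circ> \<phi>) r \<in> S}"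
      proof
        fix p assume p: "p \<in> (SIGMA j:S. {..<N j})"
        then have "p \<in> \<phi> ` bits k" using S \<phi> by (auto simp: bij_betw_def)
        then obtain r where "r \<in> bits k" "p = \<phi> r" by blast
        with p show "p \<in> \<phi> ` {r \<in> bits k. (fst \<circ> \<phi>) r \<in> S}" by (intro image_eqI[of _ _ r]) auto
      qed
    qed
    moreover have "inj_on \<phi> {r \<in> bits k. (fst \<circ> \<phi>) r \<in> S}"
      using \<phi> by (auto simp: bij_betw_def intro: inj_on_subset)
    ultimately have "card {r \<in> bits k. (fst \<circ> \<phi>) r \<in> S} = card (SIGMA j:S. {..<N j})"
      by (metis card_image)
    also have "\<dots> = (\<Sum>j\<in>S. N j)"
      using S assms(1) finite_subset by (subst card_SigmaI) auto
    finally show "card {r \<in> bits k. (fst \<circ> \<phi>) r \<in> S} = (\<Sum>j\<in>S. N j)" .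
  qed
qed

text \<open>
  An outcome \<open>Inl i\<close> makes Alice accept unless test \<open>i\<close> succeeds; \<open>Inr b\<close> makes her answer \<open>b\<close>
  outright, which moves the threshold to \<open>1 / 2\<close>.
\<close>

lemma threshold_sampler:
  fixes a :: "'i \<Rightarrow> real"
  assumes "finite I" "\<And>i. a i \<ge> 0"
  obtains k and smp :: "bool list \<Rightarrow> 'i + bool"
  where "\<And>r. r \<in> bits k \<Longrightarrow> smp r \<in> I <+> UNIV"
    and "\<And>S. S \<subseteq> I \<Longrightarrow> (\<Sum>i\<in>S. a i) \<le> \<tau> \<Longrightarrow>
      measure_pmf.prob (pmf_of_set (bits k)) {r. smp r \<in> (I - S) <+> {True}} > 1 / 2"
    and "\<And>S. S \<subseteq> I \<Longrightarrow> (\<Sum>i\<in>S. a i) > \<tau> \<Longrightarrow>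
      measure_pmf.prob (pmf_of_set (bits k)) {r. smp r \<in> (I - S) <+> {True}} < 1 / 2"
proof -
  obtain N :: "'i \<Rightarrow> nat" and \<theta> :: int where N:
    "\<And>S. S \<subseteq> I \<Longrightarrow> (\<Sum>i\<in>S. a i) \<le> \<tau> \<Longrightarrow> int (\<Sum>i\<in>S. N i) < \<theta>"
    "\<And>S. S \<subseteq> I \<Longrightarrow> (\<Sum>i\<in>S. a i) > \<tau> \<Longrightarrow> int (\<Sum>i\<in>S. N i) > \<theta>"
    by (fact integer_threshold_weights[where a = a, OF assms])
  define A where "A = (\<Sum>i\<in>I. N i)"
  \<comment> \<open>Private coins are free, so \<open>k\<close> is simply taken large enough for
    \<open>yes\<close> and \<open>no\<close> to be nonnegative.\<close>
  define k where "k = nat \<bar>\<theta>\<bar> + A"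
  have "k < 2 ^ k" by simp
  then have big: "int A + \<bar>\<theta>\<bar> < 2 ^ k"
    unfolding k_def by (simp flip: of_nat_less_iff[where 'a = int])
  \<comment> \<open>With these counts the total weight is \<open>2 ^ Suc k\<close>, while the
    accepting outcomes weigh \<open>2 ^ k\<close> plus \<theta> minus the weight of
    \<open>S\<close>. The comparison with \<theta> thus becomes a comparison with 1/2.\<close>
  define yes where "yes = nat (2 ^ k + \<theta> - int A)"
  define no where "no = nat (2 ^ k - \<theta>)"
  have yes: "int yes = 2 ^ k + \<theta> - int A" and no: "int no = 2 ^ k - \<theta>"
    using big by (auto simp: yes_def no_def)
  define N' where "N' = case_sum N (\<lambda>b. if b then yes else no)"
  have N': "(\<Sum>j\<in>S <+> T. N' j) = (\<Sum>i\<in>S. N i) + (\<Sum>b\<in>T. if b then yes else no)"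
    if "S \<subseteq> I" for S T
    using that assms(1) finite_subset by (subst sum.Plus) (auto simp: N'_def)
  have "int (\<Sum>j\<in>I <+> UNIV. N' j) = int (2 ^ Suc k)"
    using yes no by (subst N') (auto simp: UNIV_bool A_def)
  then have "(\<Sum>j\<in>I <+> UNIV. N' j) = 2 ^ Suc k" by linarith
  then obtain smp where smp: "\<And>r. r \<in> bits (Suc k) \<Longrightarrow> smp r \<in> I <+> UNIV"
    "\<And>S. S \<subseteq> I <+> UNIV \<Longrightarrow> card {r \<in> bits (Suc k). smp r \<in> S} = (\<Sum>j\<in>S. N' j)"
    using sampler_with_counts[of "I <+> UNIV" N' "Suc k"] assms(1) by auto
  have prob: "measure_pmf.prob (pmf_of_set (bits (Suc k))) {r. smp r \<in> (I - S) <+> {True}} =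
      1 / 2 + real_of_int (\<theta> - int (\<Sum>i\<in>S. N i)) / 2 ^ Suc k" if S: "S \<subseteq> I" for S
  proof -
    have "int (card {r \<in> bits (Suc k). smp r \<in> (I - S) <+> {True}}) = int (\<Sum>i\<in>I - S. N i) + int yes"
      by (subst smp(2)) (auto simp: N')
    also have "int (\<Sum>i\<in>I - S. N i) = int A - int (\<Sum>i\<in>S. N i)"
      using sum.subset_diff[OF S assms(1), of N] by (simp add: A_def)
    finally have "int (card {r \<in> bits (Suc k). smp r \<in> (I - S) <+> {True}}) =
        2 ^ k + (\<theta> - int (\<Sum>i\<in>S. N i))"
      using yes by simp
    from arg_cong[OF this, of real_of_int]
    have "real (card {r \<in> bits (Suc k). smp r \<in> (I - S) <+> {True}}) =
        2 ^ k + real_of_int (\<theta> - int (\<Sum>i\<in>S. N i))"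
      by (simp only: of_int_add of_int_of_nat_eq of_int_numeral of_int_power)
    then show ?thesis
      by (simp add: measure_pmf_of_set card_bits Int_def field_simps)
  qed
  show ?thesis
  proof (rule that[of "Suc k" smp])
    show "measure_pmf.prob (pmf_of_set (bits (Suc k))) {r. smp r \<in> (I - S) <+> {True}} > 1 / 2"
      if "S \<subseteq> I" "(\<Sum>i\<in>S. a i) \<le> \<tau>" for S
    proof -
      have "real_of_int (\<theta> - int (\<Sum>i\<in>S. N i)) > 0"
        using N(1)[OF that] by linarith
      then have "real_of_int (\<theta> - int (\<Sum>i\<in>S. N i)) / 2 ^ Suc k > 0"
        by (rule divide_pos_pos) simp
      then show ?thesis unfolding prob[OF that(1)] by linarith
    qed
    show "measure_pmf.prob (pmf_of_set (bits (Suc k))) {r. smp r \<in> (I - S) <+> {True}} < 1 / 2"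
      if "S \<subseteq> I" "(\<Sum>i\<in>S. a i) > \<tau>" for S
    proof -
      have "real_of_int (\<theta> - int (\<Sum>i\<in>S. N i)) < 0"
        using N(2)[OF that] by linarith
      then have "real_of_int (\<theta> - int (\<Sum>i\<in>S. N i)) / 2 ^ Suc k < 0"
        by (rule divide_neg_pos) simp
      then show ?thesis unfolding prob[OF that(1)] by linarith
    qed
  qed (use smp in auto)
qed

section \<open>The protocol\<close>

text \<open>The hash reads \<open>m\<close> coins and has values below \<open>2 ^ Suc m\<close>; the
  \<open>card I + 2\<close> sampler outcomes fit into \<open>d\<close> bits. Hence a message needs
  \<open>m + Suc d\<close> bits, and the last \<open>Suc d\<close> public coins are ignored. Two
  different keys collide on at most \<open>L\<close> seeds, so
  \<open>2 * card I * L <= 2 ^ m\<close> leaves at least half of the seeds free of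
  collisions.\<close>

lemma equality_tests_protocol:
  fixes a :: "'i \<Rightarrow> real" and f g :: "'i \<Rightarrow> bool list \<Rightarrow> nat"
  assumes "finite I" "\<And>i. a i \<ge> 0"
    and fg: "\<And>i x. i \<in> I \<Longrightarrow> x \<in> bits n \<Longrightarrow> f i x < 2 ^ L \<and> g i x < 2 ^ L"
    and F: "\<And>x y. x \<in> bits n \<Longrightarrow> y \<in> bits n \<Longrightarrow>
       F x y \<longleftrightarrow> (\<Sum>i\<in>{i \<in> I. f i x = g i y}. a i) \<le> \<tau>"
    and public: "2 * card I * L \<le> 2 ^ m" "L < 2 ^ m"
    and message: "card I + 2 \<le> 2 ^ d"
  shows "has_RP_UPP_protocol n F (m + Suc d)"
proof -
  let ?c = "m + Suc d"
  obtain h :: "nat \<Rightarrow> bool list \<Rightarrow> nat" where "(\<forall>j<2 ^ L. h j \<in> bits m \<rightarrow>\<^sub>E {..<2 ^ Suc m}) \<and>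
    (\<forall>i<2 ^ L. \<forall>j<2 ^ L. i \<noteq> j \<longrightarrow> card {z \<in> bits m. h i z = h j z} < Suc L)"
    using greedy_code[of "bits m" "2 ^ L" L "2 ^ Suc m"] public(2) card_bits[of m] by auto
  then have h:
    "\<And>j. j < 2 ^ L \<Longrightarrow> h j \<in> bits m \<rightarrow>\<^sub>E {..<2 ^ Suc m}"
    "\<And>i j. i < 2 ^ L \<Longrightarrow> j < 2 ^ L \<Longrightarrow> i \<noteq> j \<Longrightarrow> card {z \<in> bits m. h i z = h j z} \<le> L"
    by (auto simp: less_Suc_eq_le)
  obtain k and smp :: "bool list \<Rightarrow> 'i + bool" where smp:
    "\<And>r. r \<in> bits k \<Longrightarrow> smp r \<in> I <+> UNIV"
    "\<And>S. S \<subseteq> I \<Longrightarrow> (\<Sum>i\<in>S. a i) \<le> \<tau> \<Longrightarrow>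
      measure_pmf.prob (pmf_of_set (bits k)) {r. smp r \<in> (I - S) <+> {True}} > 1 / 2"
    "\<And>S. S \<subseteq> I \<Longrightarrow> (\<Sum>i\<in>S. a i) > \<tau> \<Longrightarrow>
      measure_pmf.prob (pmf_of_set (bits k)) {r. smp r \<in> (I - S) <+> {True}} < 1 / 2"
    by (fact threshold_sampler[where a = a, OF assms(1,2)])
  define Msg where "Msg = (I <+> (UNIV :: bool set)) \<times> {..<2 ^ Suc m :: nat}"
  have "card Msg = (card I + 2) * 2 ^ Suc m"
    using assms(1) by (simp add: Msg_def card_cartesian_product card_Plus)
  also have "\<dots> \<le> 2 ^ d * 2 ^ Suc m"
    using message by (rule mult_right_mono) simp
  also have "\<dots> = card (bits ?c)"
    by (simp add: card_bits power_add)
  finally obtain enc where enc: "inj_on enc Msg" "enc ` Msg \<subseteq> bits ?c"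
    using assms(1) by (metis Msg_def card_le_inj finite_Plus finite_SigmaI finite_bits
        finite_code finite_lessThan)
  \<comment> \<open>For an outright answer the hash component is a dummy 0, which Alice
    ignores.\<close>
  define msg where "msg y z r =
    (smp r, case smp r of Inl i \<Rightarrow> h (g i y) (take m z) | Inr b \<Rightarrow> 0)" for y z r
  define bob where "bob y z r = enc (msg y z r)" for y z r
  define alice where "alice x z \<mu> = (case inv_into Msg enc \<mu> of
      (Inl i, v) \<Rightarrow> h (f i x) (take m z) \<noteq> v | (Inr b, v) \<Rightarrow> b)" for x z \<mu>
  \<comment> \<open>The tests that succeed after hashing: all true equalities, plus any collisions.
    This is the set passed to the sampler as \<open>S\<close>.\<close>
  define H where "H x y z = {i \<in> I. h (f i x) (take m z) = h (g i y) (take m z)}" for x y z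
  have msg: "msg y z r \<in> Msg" if "y \<in> bits n" "z \<in> bits ?c" "r \<in> bits k" for y z r
  proof (cases "smp r")
    case (Inl i)
    then have "i \<in> I" using smp(1)[OF that(3)] by auto
    moreover have "take m z \<in> bits m" using that(2) by (simp add: bits_def)
    ultimately have "h (g i y) (take m z) < 2 ^ Suc m"
      using h(1) fg that(1) by (fastforce simp: PiE_iff)
    with Inl \<open>i \<in> I\<close> show ?thesis by (auto simp: Msg_def msg_def)
  qed (auto simp: Msg_def msg_def)
  have acc: "accept_prob k bob alice x y z =
      measure_pmf.prob (pmf_of_set (bits k)) {r. smp r \<in> (I - H x y z) <+> {True}}"
    if "x \<in> bits n" "y \<in> bits n" "z \<in> bits ?c" for x y z
  proof -
    have "alice x z (bob y z r) \<longleftrightarrow> smp r \<in> (I - H x y z) <+> {True}" if "r \<in> bits k" for r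
      using smp(1)[OF that] inv_into_f_f[OF enc(1) msg[OF \<open>y \<in> bits n\<close> \<open>z \<in> bits ?c\<close> that]]
      by (auto simp: alice_def bob_def H_def msg_def split: sum.splits)
    then have "bits k \<inter> {r. alice x z (bob y z r)} =
        bits k \<inter> {r. smp r \<in> (I - H x y z) <+> {True}}"
      by auto
    then show ?thesis
      unfolding accept_prob_def by (simp only: measure_pmf_of_set finite_bits bits_nonempty not_False_eq_True)
  qed
  show ?thesis
    unfolding has_RP_UPP_protocol_def
  proof (intro exI[of _ k] exI[of _ bob] exI[of _ alice] conjI ballI impI)
    show "bob y z r \<in> bits ?c" if "y \<in> bits n" "z \<in> bits ?c" "r \<in> bits k" for y z r
      using msg[OF that] enc(2) by (auto simp: bob_def)
  next
    fix x y z assume xy: "x \<in> bits n" "y \<in> bits n" and "\<not> F x y" and z: "z \<in> bits ?c"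
    then have "\<tau> < (\<Sum>i\<in>{i \<in> I. f i x = g i y}. a i)"
      using F by auto
    also have "\<dots> \<le> (\<Sum>i\<in>H x y z. a i)"
      using assms(1,2) by (intro sum_mono2) (auto simp: H_def)
    finally show "accept_prob k bob alice x y z < 1 / 2"
      unfolding acc[OF xy z] by (intro smp(3)) (auto simp: H_def)
  next
    fix x y assume xy: "x \<in> bits n" "y \<in> bits n" and "F x y"
    let ?good = "{z \<in> bits ?c. accept_prob k bob alice x y z > 1 / 2}"
    let ?coll = "\<lambda>i. {z \<in> bits ?c. h (f i x) (take m z) = h (g i y) (take m z)}"
    let ?D = "{i \<in> I. f i x \<noteq> g i y}"
    have sub: "bits ?c - (\<Union>i\<in>?D. ?coll i) \<subseteq> ?good"
    proof
      fix z assume z: "z \<in> bits ?c - (\<Union>i\<in>?D. ?coll i)"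
      then have "H x y z = {i \<in> I. f i x = g i y}" by (auto simp: H_def)
      then have "(\<Sum>i\<in>H x y z. a i) \<le> \<tau>"
        using F[OF xy] \<open>F x y\<close> by simp
      moreover have "H x y z \<subseteq> I" by (auto simp: H_def)
      ultimately have "accept_prob k bob alice x y z > 1 / 2"
        using acc[OF xy, of z] smp(2)[of "H x y z"] z by simp
      with z show "z \<in> ?good" by simp
    qed
    have "card (\<Union>i\<in>?D. ?coll i) \<le> (\<Sum>i\<in>?D. card (?coll i))"
      using assms(1) by (intro card_UN_le) auto
    also have "\<dots> \<le> (\<Sum>i\<in>?D. L * 2 ^ Suc d)"
    proof (rule sum_mono)
      fix i assume "i \<in> ?D"
      then have "card {z \<in> bits m. h (f i x) z = h (g i y) z} \<le> L"
        using fg xy by (intro h(2)) auto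
      then show "card (?coll i) \<le> L * 2 ^ Suc d"
        unfolding card_bits_take[where P = "\<lambda>z. h (f i x) z = h (g i y) z"]
        by (rule mult_right_mono) simp
    qed
    also have "\<dots> \<le> card I * (L * 2 ^ Suc d)"
      using card_mono[OF assms(1), of ?D] by simp
    finally have "2 * card (\<Union>i\<in>?D. ?coll i) \<le> (2 * card I * L) * 2 ^ Suc d"
      by (simp add: mult_ac)
    also have "\<dots> \<le> 2 ^ m * 2 ^ Suc d"
      using public(1) by (rule mult_right_mono) simp
    also have "\<dots> = card (bits ?c)"
      by (simp add: card_bits power_add)
    finally have "2 * card (\<Union>i\<in>?D. ?coll i) \<le> card (bits ?c)" .
    moreover have "card (bits ?c) - card (\<Union>i\<in>?D. ?coll i) \<le> card ?good"
      using card_mono[OF _ sub] diff_card_le_card_Diff[of "\<Union>i\<in>?D. ?coll i" "bits ?c"] assms(1)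
      by (auto intro: order_trans)
    ultimately have "card (bits ?c) \<le> 2 * card ?good" by linarith
    then show "real (card (bits ?c)) / 2 \<le> real (card ?good)"
      by linarith
  qed
qed

section \<open>Choice of the parameters\<close>

theorem theorem1p13:
  "\<exists>cost :: nat \<Rightarrow> nat.
     (\<lambda>s. real (cost s)) \<in> O(\<lambda>s. log 2 (real s)) \<and>
     (\<forall>(n :: nat) (F :: bool list \<Rightarrow> bool list \<Rightarrow> bool) (s :: nat).
        computed_by_thr_thr n F s \<longrightarrow> has_RP_UPP_protocol n F (cost s))"
proof -
  define l where "l s = nat \<lceil>log 2 (real s + 3)\<rceil>" for s :: nat
  \<comment> \<open>With \<open>b = 2 ^ l s\<close> at least \<open>s + 3\<close>, there are fewer
    than \<open>b * b\<close> tests on keys of fewer than \<open>b\<close> bits. So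
    \<open>d = 2 * l s\<close> suffices for the outcomes, and \<open>m = Suc (3 * l s)\<close> for
    the collision bound \<open>2 * b ^ 3\<close>.\<close>
  define cost where "cost s = Suc (3 * l s) + Suc (2 * l s)" for s
  have l: "s + 3 \<le> 2 ^ l s" for s
  proof -
    have "log 2 (real s + 3) \<le> real (l s)"
      unfolding l_def by linarith
    then have "real s + 3 \<le> 2 powr real (l s)"
      by (subst (asm) log_le_iff) auto
    then have "real (s + 3) \<le> real (2 ^ l s)"
      by (simp add: powr_realpow)
    then show ?thesis by (simp only: of_nat_le_iff)
  qed
  have "real (cost s) \<le> 5 * log 2 (real s + 3) + 7" for s
  proof -
    have "0 \<le> log 2 (real s + 3)" by simp
    then have "real (l s) \<le> log 2 (real s + 3) + 1"
      unfolding l_def by linarith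
    then show ?thesis by (simp add: cost_def)
  qed
  then have "(\<lambda>s. real (cost s)) \<in> O(\<lambda>s. 5 * log 2 (real s + 3) + 7)"
    by (intro landau_o.big_mono always_eventually allI) (simp add: order_trans[OF _ abs_ge_self])
  also have "(\<lambda>s. 5 * log 2 (real s + 3) + 7) \<in> O(\<lambda>s. log 2 (real s))"
    by real_asymp
  finally have O: "(\<lambda>s. real (cost s)) \<in> O(\<lambda>s. log 2 (real s))" .
  have "has_RP_UPP_protocol n F (cost s)" if circuit: "computed_by_thr_thr n F s" for n F s
  proof -
    obtain I :: "(nat \<times> nat) set" and a :: "nat \<times> nat \<Rightarrow> real"
      and f g :: "nat \<times> nat \<Rightarrow> bool list \<Rightarrow> nat" and \<tau> :: real where I:
      "finite I" "card I \<le> s * s" "\<And>i. a i \<ge> 0"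
      "\<And>i x. i \<in> I \<Longrightarrow> x \<in> bits n \<Longrightarrow> f i x < 2 ^ (s + 2) \<and> g i x < 2 ^ (s + 2)"
      "\<And>x y. x \<in> bits n \<Longrightarrow> y \<in> bits n \<Longrightarrow>
         F x y \<longleftrightarrow> (\<Sum>i\<in>{i \<in> I. f i x = g i y}. a i) \<le> \<tau>"
      by (fact thr_thr_as_equality_tests[OF circuit])
    define b where "b = (2 :: nat) ^ l s"
    have b: "s + 3 \<le> b" using l by (simp add: b_def)
    have "card I + 2 \<le> (s + 3) * (s + 3)"
      using I(2) by (simp add: algebra_simps)
    also have "\<dots> \<le> b * b" using b by (intro mult_mono) auto
    finally have card: "card I + 2 \<le> b * b" .
    have "2 * card I * (s + 2) \<le> 2 * (b * b) * b"
      using card b by (intro mult_mono) auto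
    also have "\<dots> = 2 ^ Suc (3 * l s)"
      by (simp add: b_def numeral_3_eq_3 power_add)
    finally have public: "2 * card I * (s + 2) \<le> 2 ^ Suc (3 * l s)" .
    have "(2::nat) ^ l s \<le> 2 ^ Suc (3 * l s)"
      by (intro power_increasing) auto
    then have "s + 2 < 2 ^ Suc (3 * l s)"
      using b unfolding b_def by linarith
    moreover have "card I + 2 \<le> 2 ^ (2 * l s)"
      using card by (simp add: b_def mult_2 power_add)
    ultimately show ?thesis
      unfolding cost_def using I public
      by (intro equality_tests_protocol[where I = I and a = a and f = f and g = g
            and \<tau> = \<tau> and L = "s + 2"]) auto
  qed
  with O show ?thesis by blast
qed

end
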